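(* Let $d\geq 2$ be an integer and let $G$ be a $d$-regular (finite, simple) graph on $n$ vertices. Then the number $F(G)$ of spanning forests of $G$ satisfies $F(G)\leq d^n$.
   Context: A spanning forest of $G$ is an acyclic subset $A\subseteq E(G)$ of edges (considered as a graph on the full vertex set $V(G)$); $F(G)$ denotes the number of such edge sets, including the empty set. *)

theory Defs
  imports Main
begin

definition simple_graph :: "'a set \<Rightarrow> 'a set set \<Rightarrow> bool" where
  "simple_graph V E \<longleftrightarrow> (\<forall>e\<in>E. e \<subseteq> V \<and> card e = 2)"

definition vertex_degree :: "'a set set \<Rightarrow> 'a \<Rightarrow> nat" where
  "vertex_degree E v = card {e \<in> E. v \<in> e}"

definition regular_graph :: "'a set \<Rightarrow> 'a set set \<Rightarrow> nat \<Rightarrow> bool" where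
  "regular_graph V E d \<longleftrightarrow> (\<forall>v\<in>V. vertex_degree E v = d)"

(* A cycle is listed by its vertices in cyclic order, without repeating the first one at the
   end. The length bound excludes traversing one edge back and forth. *)
definition is_cycle :: "'a set \<Rightarrow> 'a set set \<Rightarrow> 'a list \<Rightarrow> bool" where
  "is_cycle V E vs \<longleftrightarrow>
     length vs \<ge> 3 \<and> distinct vs \<and> set vs \<subseteq> V \<and>
     (\<forall>i<length vs. {vs ! i, vs ! (Suc i mod length vs)} \<in> E)"

definition acyclic_graph :: "'a set \<Rightarrow> 'a set set \<Rightarrow> bool" where
  "acyclic_graph V E \<longleftrightarrow> (\<nexists>vs. is_cycle V E vs)"

definition spanning_forests :: "'a set \<Rightarrow> 'a set set \<Rightarrow> 'a set set set" where
  "spanning_forests V E = {A. A \<subseteq> E \<and> acyclic_graph V A}"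

definition num_spanning_forests :: "'a set \<Rightarrow> 'a set set \<Rightarrow> nat" where
  "num_spanning_forests V E = card (spanning_forests V E)"

(* Guards against the convention that infinite sets have cardinality 0. *)
lemma finite_spanning_forests:
  assumes "finite V" and "simple_graph V E"
  shows "finite (spanning_forests V E)"
proof -
  have "E \<subseteq> Pow V" using assms(2) by (auto simp: simple_graph_def)
  then have "finite E" using assms(1) by (meson finite_Pow_iff finite_subset)
  moreover have "spanning_forests V E \<subseteq> Pow E" by (auto simp: spanning_forests_def)
  ultimately show ?thesis by (meson finite_Pow_iff finite_subset)
qed

end

(* Let F(S) be the number of forests in which the vertices of S lie in distinct components.
   Deleting the first edge on the path from v to S, and adding an edge uv between two
   components, gives
     F(S) + 2 * (SUM u : N(v) - S. F(S + u + v)) <= (d + 1) * F(S + v).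
   The generating polynomials D_S(y) = (SUM T <= V - S. y^|T| F(S + T)) satisfy the same
   recursion with z = d + 1 + y in place of d + 1. Applying it twice gives
     D_{} <= (z - 2d / (z - 2(d - 1) / z)) * D_{v},
   and since the derivative of D_{} is the sum of the D_{v}, this is a lower bound for the
   logarithmic derivative of D_{}. It makes D_{}^2 / h(z)^n nondecreasing, where
   h(z) = z^2 - 2d - 2d(d - 1) / z^2, and this quotient is asymptotically at most 1. At y = 0
   it yields F({})^2 <= h(d + 1)^n, and h(d + 1) <= d^2 as soon as d >= 5. For d <= 4 the trivial
   bound 2^|E| = 2^(nd/2) is enough. *)

theory Submission
  imports Defs "HOL-Real_Asymp.Real_Asymp"
begin

section \<open>Reachability, bridges and acyclic edge sets\<close>

definition linked :: "'a set set \<Rightarrow> 'a \<Rightarrow> 'a \<Rightarrow> bool" where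
  "linked B x y \<longleftrightarrow> (x, y) \<in> {(a, b). {a, b} \<in> B}\<^sup>*"

text \<open>Acyclicity in a form suited to adding and deleting single edges, with no lists of
  vertices. For an upper bound on the number of forests it suffices that acyclic edge sets have this
  property.\<close>

definition every_edge_bridge :: "'a set set \<Rightarrow> bool" where
  "every_edge_bridge B \<longleftrightarrow> (\<forall>x y. {x, y} \<in> B \<longrightarrow> \<not> linked (B - {{x, y}}) x y)"

lemma linked_refl [simp]: "linked B x x"
  by (simp add: linked_def)

lemma linked_edge: "{x, y} \<in> B \<Longrightarrow> linked B x y"
  by (auto simp: linked_def)

lemma linked_trans: "linked B x y \<Longrightarrow> linked B y z \<Longrightarrow> linked B x z"
  by (auto simp: linked_def)

lemma linked_sym: "linked B x y \<Longrightarrow> linked B y x"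
proof -
  have "sym {(a, b). {a, b} \<in> B}"
    by (auto simp: sym_def insert_commute)
  then show "linked B x y \<Longrightarrow> linked B y x"
    unfolding linked_def by (metis sym_rtrancl symD)
qed

lemma linked_mono: "linked B x y \<Longrightarrow> B \<subseteq> C \<Longrightarrow> linked C x y"
  unfolding linked_def by (erule rtrancl_mono[THEN subsetD, rotated]) auto

lemma linked_induct [consumes 1, case_names refl step]:
  assumes "linked B x y" "P x"
    and "\<And>a b. linked B x a \<Longrightarrow> {a, b} \<in> B \<Longrightarrow> P a \<Longrightarrow> P b"
  shows "P y"
  using assms(1) unfolding linked_def
  by (induction rule: rtrancl_induct) (use assms in \<open>auto simp: linked_def\<close>)

text \<open>A walk can be shortened until it crosses the new edge at most once: in the induction,
  crossing back returns to an earlier case.\<close>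

lemma linked_insert_cases:
  assumes "linked (insert {u, v} B) x y"
  shows "linked B x y \<or> linked B x u \<and> linked B v y \<or> linked B x v \<and> linked B u y"
  using assms
proof (induction rule: linked_induct)
  case (step a b)
  show ?case
  proof (cases "{a, b} \<in> B")
    case True
    then show ?thesis using step.IH linked_edge linked_trans by metis
  next
    case False
    then have "a = u \<and> b = v \<or> a = v \<and> b = u"
      using step.hyps(2) by (auto simp: doubleton_eq_iff)
    then show ?thesis using step.IH by auto
  qed
qed simp

text \<open>Take the edge by which the walk leaves \<open>v\<close> for the last time; the rest of
  the walk avoids \<open>v\<close> and hence that edge. In the induction, every return to
  \<open>v\<close> resets the claim to the disjunct \<open>v = s\<close>.\<close>

lemma linked_first_edge:
  assumes "linked B v s" "v \<noteq> s"
  shows "\<exists>u. {v, u} \<in> B \<and> linked (B - {{v, u}}) u s"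
proof -
  have "v = s \<or> (\<exists>u. {v, u} \<in> B \<and> linked (B - {{v, u}}) u s)"
    using assms(1)
  proof (induction rule: linked_induct)
    case (step a b)
    show ?case
    proof (cases "v = a")
      case True
      then show ?thesis using step.hyps(2) by auto
    next
      case False
      then obtain u where u: "{v, u} \<in> B" "linked (B - {{v, u}}) u a"
        using step.IH by auto
      show ?thesis
      proof (cases "b = v")
        case bv: False
        then have "{a, b} \<noteq> {v, u}" using False by (auto simp: doubleton_eq_iff)
        then have "linked (B - {{v, u}}) a b" using step.hyps(2) by (auto intro: linked_edge)
        then show ?thesis using u linked_trans by metis
      qed simp
    qed
  qed simp
  then show ?thesis using assms(2) by simp
qed

lemma every_edge_bridge_subset: "every_edge_bridge B \<Longrightarrow> C \<subseteq> B \<Longrightarrow> every_edge_bridge C"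
  unfolding every_edge_bridge_def
  by (meson Diff_mono linked_mono order_refl subsetD)

text \<open>A detour around an old edge \<open>{x, y}\<close> would have to cross the new edge; its
  two remaining pieces together with \<open>{x, y}\<close> would then link \<open>u\<close> and
  \<open>v\<close> inside \<open>B\<close>.\<close>

lemma every_edge_bridge_insert:
  assumes "every_edge_bridge B" "\<not> linked B u v"
  shows "every_edge_bridge (insert {u, v} B)"
  unfolding every_edge_bridge_def
proof (intro allI impI notI)
  fix x y
  assume xy: "{x, y} \<in> insert {u, v} B" and l: "linked (insert {u, v} B - {{x, y}}) x y"
  show False
  proof (cases "{x, y} = {u, v}")
    case True
    then have "linked B x y" using l linked_mono[of _ x y B] by auto
    then show False using True assms(2) by (auto simp: doubleton_eq_iff dest: linked_sym)
  next
    case False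
    let ?C = "B - {{x, y}}"
    have xyB: "{x, y} \<in> B" using xy False by auto
    have "linked (insert {u, v} ?C) x y"
      using l by (rule linked_mono) auto
    then have "linked ?C x y \<or> linked ?C x u \<and> linked ?C v y \<or> linked ?C x v \<and> linked ?C u y"
      by (rule linked_insert_cases)
    moreover have "\<not> linked ?C x y"
      using assms(1) xyB by (auto simp: every_edge_bridge_def)
    ultimately have "linked B x u \<and> linked B v y \<or> linked B x v \<and> linked B u y"
      by (meson Diff_subset linked_mono)
    then have "linked B u v"
      using linked_edge[OF xyB] by (meson linked_sym linked_trans)
    then show False using assms(2) by simp
  qed
qed

text \<open>When a step leads to a vertex already on the list, the list is cut off at that
  vertex.\<close>

lemma rtrancl_distinct_walk:
  assumes "(a, b) \<in> r\<^sup>*"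
  shows "\<exists>xs. distinct xs \<and> xs \<noteq> [] \<and> hd xs = a \<and> last xs = b \<and>
    (\<forall>i. Suc i < length xs \<longrightarrow> (xs ! i, xs ! Suc i) \<in> r)"
  using assms
proof (induction rule: rtrancl_induct)
  case base
  show ?case by (intro exI[of _ "[a]"]) auto
next
  case (step b c)
  then obtain xs where xs: "distinct xs" "xs \<noteq> []" "hd xs = a" "last xs = b"
    "\<forall>i. Suc i < length xs \<longrightarrow> (xs ! i, xs ! Suc i) \<in> r" by blast
  show ?case
  proof (cases "c \<in> set xs")
    case True
    then obtain k where k: "k < length xs" "xs ! k = c" by (auto simp: in_set_conv_nth)
    have "last (take (Suc k) xs) = c" using k by (simp add: take_Suc_conv_app_nth)
    then show ?thesis
      by (intro exI[of _ "take (Suc k) xs"]) (use xs in \<open>auto simp: hd_conv_nth\<close>)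
  next
    case False
    have "(xs ! i, (xs @ [c]) ! Suc i) \<in> r" if "i < length xs" for i
    proof (cases "Suc i < length xs")
      case True
      then show ?thesis using xs(5) by (auto simp: nth_append)
    next
      case False
      then have "Suc i = length xs" using that by simp
      then have "xs ! i = b" using xs(2,4) by (metis last_conv_nth diff_Suc_1)
      then show ?thesis using \<open>Suc i = length xs\<close> step.hyps(2) by (auto simp: nth_append)
    qed
    then show ?thesis
      by (intro exI[of _ "xs @ [c]"]) (use xs False in \<open>auto simp: nth_append\<close>)
  qed
qed

text \<open>A repetition-free detour around an edge \<open>{x, y}\<close> is closed into a cycle by
  that edge.\<close>

lemma acyclic_graph_every_edge_bridge:
  assumes "simple_graph V B" "acyclic_graph V B"
  shows "every_edge_bridge B"
  unfolding every_edge_bridge_def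
proof (intro allI impI notI)
  fix x y
  assume xy: "{x, y} \<in> B" and "linked (B - {{x, y}}) x y"
  then obtain xs where xs: "distinct xs" "xs \<noteq> []" "hd xs = x" "last xs = y"
    and st: "\<And>i. Suc i < length xs \<Longrightarrow> {xs ! i, xs ! Suc i} \<in> B - {{x, y}}"
    unfolding linked_def by (auto dest!: rtrancl_distinct_walk)
  have "x \<noteq> y" using xy assms(1) by (auto simp: simple_graph_def)
  then have "length xs \<noteq> 1" using xs by (auto simp: length_Suc_conv)
  \<comment> \<open>A detour with two vertices would be the deleted edge itself.\<close>
  moreover have "length xs \<noteq> 2"
  proof
    assume "length xs = 2"
    then obtain p q where "xs = [p, q]" by (auto simp: numeral_2_eq_2 length_Suc_conv)
    then show False using xs st[of 0] by simp
  qed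
  moreover have "length xs \<noteq> 0" using xs by simp
  ultimately have len: "length xs \<ge> 3" by linarith
  have edges: "{xs ! i, xs ! (Suc i mod length xs)} \<in> B" if "i < length xs" for i
  proof (cases "Suc i < length xs")
    case True
    then show ?thesis using st[of i] by simp
  next
    case False
    \<comment> \<open>At the last index the successor wraps round to \<open>0\<close>, and the
      closing edge is \<open>{x, y}\<close>.\<close>
    then have i: "i = length xs - 1" "Suc i = length xs" using that by auto
    then show ?thesis using xs xy by (simp add: last_conv_nth hd_conv_nth insert_commute)
  qed
  have "set xs \<subseteq> V"
    using edges assms(1) by (fastforce simp: simple_graph_def in_set_conv_nth)
  then have "is_cycle V B xs"
    using len xs(1) edges by (simp add: is_cycle_def)
  then show False using assms(2) by (auto simp: acyclic_graph_def)
qed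

section \<open>Forests that separate a vertex set, and their recursion\<close>

text \<open>The cardinality is the F(S) of the introduction. For \<open>S = {}\<close> only the
  forest condition remains.\<close>

definition separating_forests :: "'a set set \<Rightarrow> 'a set \<Rightarrow> 'a set set set" where
  "separating_forests E S =
     {B. B \<subseteq> E \<and> every_edge_bridge B \<and> (\<forall>s\<in>S. \<forall>t\<in>S. s \<noteq> t \<longrightarrow> \<not> linked B s t)}"

lemma finite_separating_forests: "finite E \<Longrightarrow> finite (separating_forests E S)"
  by (rule finite_subset[of _ "Pow E"]) (auto simp: separating_forests_def)

text \<open>If the component of \<open>v\<close> meets \<open>S\<close> in \<open>s\<close>,
  deleting the edge from \<open>v\<close> towards \<open>s\<close> cuts \<open>v\<close> off from
  \<open>S\<close>, while the other end \<open>u\<close> stays linked to \<open>s\<close>. Recording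
  \<open>u\<close> makes the deletion reversible.\<close>

lemma separating_forests_split:
  assumes "v \<notin> S"
  shows "separating_forests E S \<subseteq> separating_forests E (insert v S) \<union>
    (\<Union>u\<in>{u. {v, u} \<in> E}. insert {v, u} `
       {B \<in> separating_forests E (insert v S). \<exists>s\<in>S. linked B u s})"
proof
  fix B assume B: "B \<in> separating_forests E S"
  show "B \<in> separating_forests E (insert v S) \<union>
    (\<Union>u\<in>{u. {v, u} \<in> E}. insert {v, u} `
       {B \<in> separating_forests E (insert v S). \<exists>s\<in>S. linked B u s})"
  proof (cases "\<exists>s\<in>S. linked B v s")
    case False
    then have "B \<in> separating_forests E (insert v S)"
      using B by (auto simp: separating_forests_def dest: linked_sym)
    then show ?thesis by simp
  next
    case True
    then obtain s where s: "s \<in> S" "linked B v s" by blast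
    then have "v \<noteq> s" using assms by auto
    then obtain u where u: "{v, u} \<in> B" "linked (B - {{v, u}}) u s"
      using linked_first_edge s(2) by metis
    let ?B = "B - {{v, u}}"
    have sub: "linked B a b" if "linked ?B a b" for a b
      using that by (rule linked_mono) auto
    have sep: "\<not> linked B a b" if "a \<in> S" "b \<in> S" "a \<noteq> b" for a b
      using B that by (auto simp: separating_forests_def)
    have "\<not> linked ?B v t" if "t \<in> S" for t
    proof
      assume l: "linked ?B v t"
      show False
      \<comment> \<open>For \<open>t = s\<close> the edge \<open>{v, u}\<close> would have a detour
        and not be a bridge; for \<open>t\<close> different from \<open>s\<close>, both would lie in
        one component of \<open>B\<close>.\<close>
      proof (cases "t = s")
        case True
        then have "linked ?B v u" using l u(2) linked_sym linked_trans by metis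
        then show False
          using B u(1) by (auto simp: separating_forests_def every_edge_bridge_def)
      next
        case False
        then show False using sep[of t s] sub[OF l] s that linked_sym linked_trans by metis
      qed
    qed
    moreover have "every_edge_bridge ?B"
      using B by (auto simp: separating_forests_def intro: every_edge_bridge_subset)
    ultimately have "?B \<in> separating_forests E (insert v S)"
      using B sub sep unfolding separating_forests_def by (blast dest: linked_sym)
    moreover have "B = insert {v, u} ?B" "{v, u} \<in> E"
      using u B by (auto simp: separating_forests_def)
    ultimately show ?thesis using s(1) u(2) by blast
  qed
qed

text \<open>Each forest on the left gives two on the right, itself and itself with
  \<open>{v, u}\<close> added. These are distinct because the first never contains that edge, and
  joining the components of \<open>u\<close> and \<open>v\<close> brings neither to
  \<open>S\<close>.\<close>

lemma separating_forests_extend: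
  assumes "finite E" "{v, u} \<in> E" "u \<noteq> v" "u \<notin> S" "v \<notin> S"
  shows "2 * card (separating_forests E (insert u (insert v S))) \<le>
    card {B \<in> separating_forests E (insert v S). \<forall>s\<in>S. \<not> linked B u s}"
proof -
  let ?X = "separating_forests E (insert u (insert v S))"
  let ?Y = "{B \<in> separating_forests E (insert v S). \<forall>s\<in>S. \<not> linked B u s}"
  have notin: "{v, u} \<notin> B" if "B \<in> ?X" for B
    using that assms(3) linked_edge[of v u B] by (auto simp: separating_forests_def)
  have 1: "?X \<subseteq> ?Y" using assms by (auto simp: separating_forests_def)
  have 2: "insert {v, u} B \<in> ?Y" if B: "B \<in> ?X" for B
  proof -
    have sep: "\<not> linked B a b"
      if "a \<in> insert u (insert v S)" "b \<in> insert u (insert v S)" "a \<noteq> b" for a b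
      using B that by (auto simp: separating_forests_def)
    let ?C = "insert {v, u} B"
    have "every_edge_bridge ?C"
      using B sep[of v u] assms(3)
      by (intro every_edge_bridge_insert) (auto simp: separating_forests_def)
    moreover have uv: "\<not> linked ?C u s" "\<not> linked ?C v s" "\<not> linked ?C s v" if "s \<in> S" for s
      using that assms sep linked_insert_cases[of v u B u s] linked_insert_cases[of v u B v s]
        linked_insert_cases[of v u B s v] by blast+
    moreover have "\<not> linked ?C s t" if "s \<in> S" "t \<in> S" "s \<noteq> t" for s t
      using that assms sep linked_insert_cases[of v u B s t] by blast
    ultimately show ?thesis
      using B assms(2) by (auto simp: separating_forests_def)
  qed
  have "inj_on (insert {v, u}) ?X"
    using notin by (meson inj_onI insert_ident)
  then have "card (insert {v, u} ` ?X) = card ?X" by (rule card_image)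
  moreover have "?X \<inter> insert {v, u} ` ?X = {}" using notin by auto
  moreover have fin: "finite ?X" "finite ?Y"
    using finite_separating_forests[OF assms(1)] by auto
  ultimately have "card (?X \<union> insert {v, u} ` ?X) = 2 * card ?X"
    by (subst card_Un_disjoint) auto
  moreover have "card (?X \<union> insert {v, u} ` ?X) \<le> card ?Y"
    using 1 2 fin by (intro card_mono) auto
  ultimately show ?thesis by simp
qed

text \<open>For each neighbour \<open>u\<close>, the forests separating \<open>insert v S\<close>
  divide into those where \<open>u\<close> is linked to \<open>S\<close> and those where it is not.
  The first kind controls the split of \<open>S\<close>, the second bounds twice the count for
  \<open>insert u (insert v S)\<close>.\<close>

lemma separating_forests_recursion:
  assumes "finite E" "finite {u. {v, u} \<in> E}" "{v} \<notin> E" "v \<notin> S"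
  shows "card (separating_forests E S) +
      2 * (\<Sum>u\<in>{u. {v, u} \<in> E} - S. card (separating_forests E (insert u (insert v S))))
    \<le> (card {u. {v, u} \<in> E} + 1) * card (separating_forests E (insert v S))"
proof -
  let ?N = "{u. {v, u} \<in> E}"
  let ?X = "separating_forests E (insert v S)"
  let ?in = "\<lambda>u. {B \<in> ?X. \<exists>s\<in>S. linked B u s}"
  let ?out = "\<lambda>u. {B \<in> ?X. \<forall>s\<in>S. \<not> linked B u s}"
  note fin = finite_separating_forests[OF assms(1)]
  have "card (separating_forests E S) \<le> card (?X \<union> (\<Union>u\<in>?N. insert {v, u} ` ?in u))"
    using separating_forests_split[OF assms(4)] fin assms(2) by (intro card_mono) auto
  also have "\<dots> \<le> card ?X + card (\<Union>u\<in>?N. insert {v, u} ` ?in u)"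
    by (rule card_Un_le)
  also have "card (\<Union>u\<in>?N. insert {v, u} ` ?in u) \<le> (\<Sum>u\<in>?N. card (insert {v, u} ` ?in u))"
    by (rule card_UN_le[OF assms(2)])
  also have "\<dots> \<le> (\<Sum>u\<in>?N. card (?in u))"
    using fin by (intro sum_mono card_image_le) auto
  finally have 1: "card (separating_forests E S) \<le> card ?X + (\<Sum>u\<in>?N. card (?in u))"
    by simp
  have "(\<Sum>u\<in>?N - S. 2 * card (separating_forests E (insert u (insert v S))))
      \<le> (\<Sum>u\<in>?N - S. card (?out u))"
    using assms by (intro sum_mono separating_forests_extend) auto
  also have "\<dots> \<le> (\<Sum>u\<in>?N. card (?out u))"
    using assms(2) by (intro sum_mono2) auto
  finally have 2: "2 * (\<Sum>u\<in>?N - S. card (separating_forests E (insert u (insert v S))))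
      \<le> (\<Sum>u\<in>?N. card (?out u))"
    by (simp add: sum_distrib_left)
  have "card (?in u) + card (?out u) = card ?X" for u
    using fin by (subst card_Un_disjoint[symmetric]) (auto intro: arg_cong[where f = card])
  then have "(\<Sum>u\<in>?N. card (?in u)) + (\<Sum>u\<in>?N. card (?out u)) = card ?N * card ?X"
    by (simp add: sum.distrib[symmetric])
  with 1 2 show ?thesis by simp
qed


section \<open>Real inequalities for the comparison function\<close>

text \<open>The constant \<open>c\<close> is chosen so that \<open>ln (z\<^sup>2 - 2 * d - c / z\<^sup>2) / 2\<close> agrees at infinity, up to
  the order \<open>z\<close> to the power \<open>-4\<close>, with the integral of the reciprocal of
  \<open>z - 2 * d / (z - 2 * (d - 1) / z)\<close>.\<close>

lemma quartic_comparison: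
  fixes z d :: real
  assumes "d \<ge> 1" "z \<ge> d + 1"
  defines "c \<equiv> 2 * d * (d - 1)"
  shows "z\<^sup>2 - 2 * d - c / z\<^sup>2 > 0" "z\<^sup>2 - 4 * d + 2 > 0"
    and "z * (z + c / z ^ 3) * (z\<^sup>2 - 4 * d + 2) \<le> (z\<^sup>2 - 2 * d - c / z\<^sup>2) * (z\<^sup>2 - 2 * d + 2)"
proof -
  define s where "s = z\<^sup>2"
  have s: "s \<ge> (d + 1)\<^sup>2" unfolding s_def using assms by (intro power_mono) auto
  have z: "z > 0" and c: "c \<ge> 0" using assms by auto
  have sq: "(d + 1)\<^sup>2 = (d - 1)\<^sup>2 + 4 * d" "(d + 1)\<^sup>2 = d\<^sup>2 + 2 * d + 1"
    by (simp_all add: power2_eq_square algebra_simps)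
  have s4: "s \<ge> (d - 1)\<^sup>2 + 4 * d" using s sq by simp
  then show "z\<^sup>2 - 4 * d + 2 > 0" unfolding s_def by (smt (verit) zero_le_power2)
  have s0: "s > 0" using z by (simp add: s_def)
  \<comment> \<open>Thus \<open>c / s\<close> stays below 2, while \<open>s - 2 * d\<close> is at
    least \<open>d\<^sup>2 + 1\<close> and so at least 2.\<close>
  have "c < 2 * s"
    using s assms(1) by (simp add: c_def power2_eq_square algebra_simps)
  then have "c / s < 2" using s0 by (simp add: divide_simps)
  moreover have "s - 2 * d \<ge> d\<^sup>2 + 1" using s sq by simp
  moreover have "d\<^sup>2 \<ge> 1" using assms(1) by simp
  ultimately show "z\<^sup>2 - 2 * d - c / z\<^sup>2 > 0" unfolding s_def by linarith
  have "z * (z + c / z ^ 3) = s + c / s"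
    using z by (simp add: s_def field_simps power2_eq_square power3_eq_cube)
  moreover have "(s + c / s) * (s - 4 * d + 2) \<le> (s - 2 * d - c / s) * (s - 2 * d + 2)"
  proof -
    \<comment> \<open>The terms in \<open>s\<^sup>2\<close> and \<open>s\<close> cancel for every
      \<open>c\<close>; the constant term 4d(d - 1) - 2c vanishes for the chosen
      \<open>c\<close>.\<close>
    have "(s - 2 * d - c / s) * (s - 2 * d + 2) - (s + c / s) * (s - 4 * d + 2)
        = c / s * (6 * d - 4)"
      using s0 by (simp add: c_def field_simps power2_eq_square)
    moreover have "c / s * (6 * d - 4) \<ge> 0" using c s0 assms(1) by simp
    ultimately show ?thesis by linarith
  qed
  ultimately show "z * (z + c / z ^ 3) * (z\<^sup>2 - 4 * d + 2) \<le>
      (z\<^sup>2 - 2 * d - c / z\<^sup>2) * (z\<^sup>2 - 2 * d + 2)"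
    by (simp add: s_def)
qed

lemma log_ratio_tendsto:
  fixes d c :: real
  shows "((\<lambda>y. 2 * ln (d + 1 + y) - ln ((d + 1 + y)\<^sup>2 - 2 * d - c / (d + 1 + y)\<^sup>2)) \<longlongrightarrow> 0) at_top"
  by real_asymp

section \<open>Generating polynomials and the logarithmic derivative\<close>

text \<open>Isolates what the analysis takes from the graph: nonnegative weights, their recursion,
  the normalisation at \<open>V\<close>, and neighbour sets of size \<open>d\<close>.\<close>

locale separation_weights =
  fixes V :: "'a set" and Phi :: "'a set \<Rightarrow> real" and N :: "'a \<Rightarrow> 'a set" and d :: nat
  assumes finite_V: "finite V"
    and Phi_nonneg: "\<And>S. 0 \<le> Phi S"
    and Phi_V: "Phi V \<le> 1"
    and N_subset: "\<And>v. v \<in> V \<Longrightarrow> N v \<subseteq> V - {v}"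
    and card_N: "\<And>v. v \<in> V \<Longrightarrow> card (N v) = d"
    and Phi_recursion: "\<And>S v. S \<subseteq> V \<Longrightarrow> v \<in> V - S \<Longrightarrow>
      Phi S + 2 * (\<Sum>u\<in>N v - S. Phi (insert u (insert v S))) \<le> (real d + 1) * Phi (insert v S)"
begin

definition D :: "'a set \<Rightarrow> real \<Rightarrow> real" where
  "D S y = (\<Sum>T\<in>Pow (V - S). y ^ card T * Phi (S \<union> T))"

lemma D_nonneg: "0 \<le> y \<Longrightarrow> 0 \<le> D S y"
  unfolding D_def by (intro sum_nonneg mult_nonneg_nonneg Phi_nonneg) auto

text \<open>Separates the \<open>T\<close> that avoid \<open>v\<close> from those that contain it.
  The recursion for \<open>Phi\<close> applies to the first sum; the second turns the factor
  \<open>d + 1\<close> into \<open>d + 1 + y\<close>.\<close>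

lemma D_split:
  assumes "v \<in> V - S"
  shows "D S y = (\<Sum>T\<in>Pow (V - insert v S). y ^ card T * Phi (S \<union> T)) + y * D (insert v S) y"
proof -
  let ?W = "V - insert v S"
  have W: "V - S = insert v ?W" using assms by auto
  have inj: "inj_on (insert v) (Pow ?W)"
    by (auto intro!: inj_onI)
  have "D S y = (\<Sum>T\<in>Pow ?W. y ^ card T * Phi (S \<union> T)) +
      (\<Sum>T\<in>insert v ` Pow ?W. y ^ card T * Phi (S \<union> T))"
    unfolding D_def W Pow_insert using finite_V by (intro sum.union_disjoint) auto
  also have "(\<Sum>T\<in>insert v ` Pow ?W. y ^ card T * Phi (S \<union> T)) =
      (\<Sum>T\<in>Pow ?W. y ^ card (insert v T) * Phi (S \<union> insert v T))"
    using inj by (simp add: sum.reindex)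
  also have "\<dots> = y * D (insert v S) y"
    unfolding D_def sum_distrib_left
  proof (intro sum.cong refl)
    fix T assume T: "T \<in> Pow ?W"
    then have "card (insert v T) = Suc (card T)"
      using finite_V by (intro card_insert_disjoint) (auto dest: finite_subset)
    then show "y ^ card (insert v T) * Phi (S \<union> insert v T) =
        y * (y ^ card T * Phi (insert v S \<union> T))"
      by simp
  qed
  finally show ?thesis .
qed

lemma D_recursion:
  assumes "S \<subseteq> V" "v \<in> V - S" "0 \<le> y"
  shows "D S y + 2 * (\<Sum>u\<in>N v - S. D (insert u (insert v S)) y)
    \<le> (real d + 1 + y) * D (insert v S) y"
proof -
  let ?W = "V - insert v S"
  let ?g = "\<lambda>u T. y ^ card T * Phi (insert u (insert v (S \<union> T)))"
  have finW: "finite (Pow ?W)" using finite_V by simp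
  have finN: "finite (N v)"
    using N_subset[of v] assms(2) finite_V by (auto dest: finite_subset)
  \<comment> \<open>Exchanging the sums pairs each \<open>u\<close> with the \<open>T\<close> that
    avoid it, which are exactly the index sets of \<open>D (insert u (insert v S))\<close>.\<close>
  have "(\<Sum>T\<in>Pow ?W. y ^ card T * (\<Sum>u\<in>N v - (S \<union> T). Phi (insert u (insert v (S \<union> T)))))
      = (\<Sum>T\<in>Pow ?W. \<Sum>u\<in>N v - S. if u \<in> T then 0 else ?g u T)"
    unfolding sum_distrib_left using finN
    by (intro sum.cong refl sum.mono_neutral_cong_left) auto
  also have "\<dots> = (\<Sum>u\<in>N v - S. \<Sum>T\<in>Pow ?W. if u \<in> T then 0 else ?g u T)"
    by (rule sum.swap)
  also have "\<dots> = (\<Sum>u\<in>N v - S. D (insert u (insert v S)) y)"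
    unfolding D_def using finW
    by (intro sum.cong refl sum.mono_neutral_cong_right) auto
  finally have swap: "(\<Sum>T\<in>Pow ?W. y ^ card T *
      (\<Sum>u\<in>N v - (S \<union> T). Phi (insert u (insert v (S \<union> T))))) =
      (\<Sum>u\<in>N v - S. D (insert u (insert v S)) y)" .
  have "(\<Sum>T\<in>Pow ?W. y ^ card T * Phi (S \<union> T)) \<le>
      (\<Sum>T\<in>Pow ?W. (real d + 1) * (y ^ card T * Phi (insert v S \<union> T)) -
        2 * (y ^ card T * (\<Sum>u\<in>N v - (S \<union> T). Phi (insert u (insert v (S \<union> T))))))"
  proof (intro sum_mono)
    fix T assume T: "T \<in> Pow ?W"
    have "Phi (S \<union> T) \<le> (real d + 1) * Phi (insert v (S \<union> T)) -
        2 * (\<Sum>u\<in>N v - (S \<union> T). Phi (insert u (insert v (S \<union> T))))"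
    proof -
      have "S \<union> T \<subseteq> V" "v \<in> V - (S \<union> T)" using T assms(1,2) by auto
      from Phi_recursion[OF this] show ?thesis by simp
    qed
    then have "y ^ card T * Phi (S \<union> T) \<le> y ^ card T * ((real d + 1) * Phi (insert v (S \<union> T)) -
        2 * (\<Sum>u\<in>N v - (S \<union> T). Phi (insert u (insert v (S \<union> T)))))"
      using assms(3) by (intro mult_left_mono) auto
    then show "y ^ card T * Phi (S \<union> T) \<le> (real d + 1) * (y ^ card T * Phi (insert v S \<union> T)) -
        2 * (y ^ card T * (\<Sum>u\<in>N v - (S \<union> T). Phi (insert u (insert v (S \<union> T)))))"
      by (simp add: right_diff_distrib mult_ac)
  qed
  also have "\<dots> = (real d + 1) * D (insert v S) y -
      2 * (\<Sum>u\<in>N v - S. D (insert u (insert v S)) y)"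
    unfolding sum_subtractf sum_distrib_left[symmetric] swap by (simp add: D_def)
  finally show ?thesis
    unfolding D_split[OF assms(2)] by (simp add: distrib_right)
qed

lemma D_step:
  assumes "S \<subseteq> V" "v \<in> V - S" "0 \<le> y"
  shows "D S y \<le> (real d + 1 + y) * D (insert v S) y"
proof -
  have "0 \<le> (\<Sum>u\<in>N v - S. D (insert u (insert v S)) y)"
    by (intro sum_nonneg D_nonneg assms(3))
  then show ?thesis using D_recursion[OF assms] by linarith
qed

text \<open>Starting from \<open>D V y = Phi V\<close>, each vertex removed from the separated set
  costs one factor \<open>d + 1 + y\<close>. With \<open>S = {}\<close> this controls the growth at
  infinity.\<close>

lemma D_le_power:
  assumes "S \<subseteq> V" "0 \<le> y"
  shows "D S y \<le> (real d + 1 + y) ^ card (V - S)"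
proof -
  have "D (V - T) y \<le> (real d + 1 + y) ^ card T" if "finite T" "T \<subseteq> V" for T
    using that
  proof (induction T rule: finite_induct)
    case empty
    then show ?case using Phi_V by (simp add: D_def)
  next
    case (insert v T)
    have "insert v (V - insert v T) = V - T" using insert by auto
    then have "D (V - insert v T) y \<le> (real d + 1 + y) * D (V - T) y"
      using D_step[of "V - insert v T" v y] insert.prems assms(2) by auto
    also have "\<dots> \<le> (real d + 1 + y) * (real d + 1 + y) ^ card T"
      using insert assms(2) by (intro mult_left_mono) auto
    finally show ?case using insert by simp
  qed
  from this[of "V - S"] show ?thesis
    using assms(1) finite_V by (simp add: double_diff)
qed

text \<open>First use of the recursion, at \<open>u\<close> with \<open>S = {v}\<close>:
  \<open>D_step\<close> bounds the triple terms from below, and \<open>u\<close> has at least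
  \<open>d - 1\<close> neighbours other than \<open>v\<close>.\<close>

lemma D_pair_lower_bound:
  assumes "v \<in> V" "u \<in> V" "u \<noteq> v" "d \<ge> 1" "0 \<le> y"
  defines "z \<equiv> real d + 1 + y"
  shows "z * D {v} y \<le> (z\<^sup>2 - 2 * (real d - 1)) * D {u, v} y"
proof -
  have z: "z > 0" using assms by simp
  have fin: "finite (N u)" using N_subset[OF assms(2)] finite_V by (auto dest: finite_subset)
  have "D {u, v} y \<le> z * D {w, u, v} y" if "w \<in> N u - {v}" for w
    using D_step[of "{u, v}" w y] that N_subset[OF assms(2)] assms by auto
  then have "(\<Sum>w\<in>N u - {v}. D {u, v} y) \<le> (\<Sum>w\<in>N u - {v}. z * D {w, u, v} y)"
    by (intro sum_mono) auto
  moreover have "card (N u - {v}) \<ge> d - 1"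
    using card_N[OF assms(2)] fin by (simp add: card_Diff_singleton_if)
  then have "(real d - 1) * D {u, v} y \<le> card (N u - {v}) * D {u, v} y"
    using D_nonneg[OF assms(5)] by (intro mult_right_mono) auto
  ultimately have "(real d - 1) * D {u, v} y \<le> z * (\<Sum>w\<in>N u - {v}. D {w, u, v} y)"
    by (simp add: sum_distrib_left)
  moreover have "z * (D {v} y + 2 * (\<Sum>w\<in>N u - {v}. D {w, u, v} y)) \<le> z * (z * D {u, v} y)"
    using D_recursion[of "{v}" u y] assms z by (intro mult_left_mono) auto
  ultimately show ?thesis
    by (simp add: algebra_simps power2_eq_square)
qed

text \<open>Second use of the recursion, at \<open>v\<close> with \<open>S = {}\<close>, with the
  previous bound inserted for each of the \<open>d\<close> neighbours. Denominators are
  cleared.\<close>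

lemma D_vertex_lower_bound:
  assumes "v \<in> V" "d \<ge> 1" "0 \<le> y"
  defines "z \<equiv> real d + 1 + y"
  shows "(z\<^sup>2 - 2 * real d + 2) * D {} y \<le> z * (z\<^sup>2 - 4 * real d + 2) * D {v} y"
proof -
  let ?q = "z\<^sup>2 - 2 * real d + 2"
  have "(real d + 1)\<^sup>2 \<le> z\<^sup>2"
    using assms by (intro power_mono) auto
  then have "(real d)\<^sup>2 + 1 + 2 * real d \<le> z\<^sup>2" by (simp add: power2_sum)
  then have q: "?q \<ge> 0" using zero_le_power2[of "real d"] by linarith
  have "z * D {v} y \<le> ?q * D {u, v} y" if "u \<in> N v" for u
    using D_pair_lower_bound[of v u y] that N_subset[OF assms(1)] assms by (auto simp: algebra_simps)
  then have "(\<Sum>u\<in>N v. z * D {v} y) \<le> (\<Sum>u\<in>N v. ?q * D {u, v} y)"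
    by (intro sum_mono)
  then have "real d * (z * D {v} y) \<le> ?q * (\<Sum>u\<in>N v. D {u, v} y)"
    using card_N[OF assms(1)] by (simp add: sum_distrib_left)
  moreover have "?q * (D {} y + 2 * (\<Sum>u\<in>N v. D {u, v} y)) \<le> ?q * (z * D {v} y)"
    using D_recursion[of "{}" v y] assms q by (intro mult_left_mono) auto
  ultimately show ?thesis
    by (simp add: algebra_simps power2_eq_square)
qed

text \<open>The factor \<open>card T\<close> from differentiation counts the choices of
  \<open>v\<close> in \<open>T\<close>; removing \<open>v\<close> from \<open>T\<close> then gives
  the terms of \<open>D {v}\<close>.\<close>

lemma DERIV_D_empty: "((\<lambda>y. D {} y) has_real_derivative (\<Sum>v\<in>V. D {v} y)) (at y)"
proof -
  have eq: "(\<Sum>T\<in>Pow V. real (card T) * y ^ (card T - 1) * Phi T) = (\<Sum>v\<in>V. D {v} y)"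
  proof -
    have "(\<Sum>T\<in>Pow V. real (card T) * y ^ (card T - 1) * Phi T) =
        (\<Sum>T\<in>Pow V. \<Sum>v\<in>V. if v \<in> T then y ^ (card T - 1) * Phi T else 0)"
      using finite_V by (intro sum.cong refl) (simp add: sum.If_cases Int_absorb1)
    also have "\<dots> = (\<Sum>v\<in>V. \<Sum>T\<in>Pow V. if v \<in> T then y ^ (card T - 1) * Phi T else 0)"
      by (rule sum.swap)
    also have "\<dots> = (\<Sum>v\<in>V. D {v} y)"
    proof (intro sum.cong refl)
      fix v assume v: "v \<in> V"
      have inj: "inj_on (insert v) (Pow (V - {v}))"
        by (auto intro!: inj_onI)
      have "(\<Sum>T\<in>Pow V. if v \<in> T then y ^ (card T - 1) * Phi T else 0) =
          (\<Sum>T\<in>insert v ` Pow (V - {v}). y ^ (card T - 1) * Phi T)"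
      proof (rule sum.mono_neutral_cong_right)
        have "T \<in> insert v ` Pow (V - {v})" if "T \<subseteq> V" "v \<in> T" for T
          using that by (intro image_eqI[of _ _ "T - {v}"]) auto
        then show "\<forall>T\<in>Pow V - insert v ` Pow (V - {v}).
            (if v \<in> T then y ^ (card T - 1) * Phi T else 0) = 0" by auto
      qed (use finite_V v in auto)
      also have "\<dots> = (\<Sum>T\<in>Pow (V - {v}). y ^ (card (insert v T) - 1) * Phi (insert v T))"
        using inj by (simp add: sum.reindex)
      also have "\<dots> = D {v} y"
        unfolding D_def
      proof (intro sum.cong refl)
        fix T assume T: "T \<in> Pow (V - {v})"
        then have "card (insert v T) = Suc (card T)"
          using finite_V by (intro card_insert_disjoint) (auto dest: finite_subset)
        then show "y ^ (card (insert v T) - 1) * Phi (insert v T) = y ^ card T * Phi ({v} \<union> T)"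
          by simp
      qed
      finally show "(\<Sum>T\<in>Pow V. if v \<in> T then y ^ (card T - 1) * Phi T else 0) = D {v} y" .
    qed
    finally show ?thesis .
  qed
  have "((\<lambda>y. D {} y) has_real_derivative
      (\<Sum>T\<in>Pow V. real (card T) * y ^ (card T - 1) * Phi T)) (at y)"
    unfolding D_def by (auto intro!: derivative_eq_intros simp: mult_ac)
  then show ?thesis unfolding eq .
qed


theorem Phi_empty_le:
  assumes "d \<ge> 5" "Phi {} > 0"
  shows "Phi {} \<le> real d ^ card V"
proof -
  define n where "n = real (card V)"
  define c where "c = 2 * real d * (real d - 1)"
  define h where "h = (\<lambda>z. z\<^sup>2 - 2 * real d - c / z\<^sup>2)"
  define z where "z = (\<lambda>y. real d + 1 + y)"
  \<comment> \<open>The logarithm of D_{}^2 / h(z)^n.\<close>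
  define L where "L = (\<lambda>y. 2 * ln (D {} y) - n * ln (h (z y)))"
  have d1: "real d \<ge> 1" using assms by simp
  have h_pos: "h (z y) > 0" if "y \<ge> 0" for y
    using quartic_comparison(1)[of "real d" "z y"] that d1 by (simp add: h_def z_def c_def)
  have D_pos: "D {} y > 0" if "y \<ge> 0" for y
  proof -
    have "Phi {} = (\<Sum>T\<in>{{}}. y ^ card T * Phi ({} \<union> T))" by simp
    also have "\<dots> \<le> D {} y"
      unfolding D_def using finite_V that Phi_nonneg by (intro sum_mono2) auto
    finally show ?thesis using assms(2) by simp
  qed
  have L_mono: "L 0 \<le> L y" if "y \<ge> 0" for y
  proof (rule DERIV_nonneg_imp_nondecreasing[OF that])
    fix x :: real assume x: "0 \<le> x" "x \<le> y"
    define P' where "P' = (\<Sum>v\<in>V. D {v} x)"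
    \<comment> \<open>Half the derivative of \<open>h\<close> at \<open>z x\<close>.\<close>
    define k where "k = z x + c / z x ^ 3"
    define r where "r = (z x)\<^sup>2 - 4 * real d + 2"
    define q where "q = (z x)\<^sup>2 - 2 * real d + 2"
    have zx: "z x > 0" "z x \<ge> real d + 1" using x by (auto simp: z_def)
    have hx: "h (z x) > 0" and Px: "D {} x > 0" using h_pos D_pos x by auto
    have r: "r > 0" and cmp: "z x * k * r \<le> h (z x) * q"
      using quartic_comparison(2,3)[OF d1 zx(2)] by (auto simp: r_def k_def h_def q_def c_def)
    have "(\<Sum>v\<in>V. q * D {} x) \<le> (\<Sum>v\<in>V. z x * r * D {v} x)"
      using D_vertex_lower_bound[OF _ _ x(1)] assms(1)
      by (intro sum_mono) (auto simp: q_def r_def z_def)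
    then have "n * (q * D {} x) \<le> z x * r * P'"
      by (simp add: n_def P'_def sum_distrib_left)
    then have "h (z x) * (n * (q * D {} x)) \<le> h (z x) * (z x * r * P')"
      using hx by (intro mult_left_mono) auto
    moreover have "n * D {} x * (z x * k * r) \<le> n * D {} x * (h (z x) * q)"
      using cmp Px by (intro mult_left_mono) (auto simp: n_def)
    \<comment> \<open>Cancelling the positive factor \<open>z x * r\<close> leaves P' / D_{} at
      least n k / h, that is, a nonnegative derivative of \<open>L\<close>.\<close>
    ultimately have "(z x * r) * (n * k * D {} x) \<le> (z x * r) * (h (z x) * P')"
      by (simp add: mult_ac)
    then have "n * k * D {} x \<le> h (z x) * P'"
      using zx r by (simp add: mult_le_cancel_left_pos)
    then have nonneg: "2 * (P' / D {} x) - n * (2 * k / h (z x)) \<ge> 0"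
      using hx Px by (simp add: field_simps)
    have "(h has_real_derivative 2 * z x + c * (2 * z x) / ((z x)\<^sup>2 * (z x)\<^sup>2)) (at (z x))"
      unfolding h_def using zx by (auto intro!: derivative_eq_intros)
    also have "2 * z x + c * (2 * z x) / ((z x)\<^sup>2 * (z x)\<^sup>2) = 2 * k"
      using zx by (simp add: k_def power2_eq_square power3_eq_cube mult_ac)
    finally have "((\<lambda>y. h (z y)) has_real_derivative 2 * k * 1) (at x)"
      by (rule DERIV_chain2) (auto simp: z_def intro!: derivative_eq_intros)
    then have dh: "((\<lambda>y. h (z y)) has_real_derivative 2 * k) (at x)" by simp
    have "(L has_real_derivative 2 * (P' / D {} x) - n * (2 * k / h (z x))) (at x)"
      unfolding L_def P'_def using hx Px
      by (auto intro!: derivative_eq_intros DERIV_D_empty dh simp: mult_ac)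
    with nonneg show "\<exists>l. DERIV L x :> l \<and> 0 \<le> l" by blast
  qed
  have L_upper: "L y \<le> n * (2 * ln (z y) - ln (h (z y)))" if "y \<ge> 0" for y
  proof -
    have "ln (D {} y) \<le> ln (z y ^ card V)"
      using D_le_power[of "{}" y] D_pos that by (subst ln_le_cancel_iff) (auto simp: z_def)
    also have "\<dots> = n * ln (z y)"
      using that by (simp add: n_def z_def ln_realpow)
    finally show ?thesis by (simp add: L_def algebra_simps)
  qed
  have "((\<lambda>y. n * (2 * ln (z y) - ln (h (z y)))) \<longlongrightarrow> n * 0) at_top"
    unfolding z_def h_def by (intro tendsto_intros log_ratio_tendsto)
  moreover have "eventually (\<lambda>y. L 0 \<le> n * (2 * ln (z y) - ln (h (z y)))) at_top"
    using eventually_ge_at_top[of 0] by eventually_elim (use L_mono L_upper order_trans in blast)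
  \<comment> \<open>The constant \<open>L 0\<close> lies below \<open>L y\<close>, hence below a
    function that tends to 0.\<close>
  ultimately have "L 0 \<le> n * 0"
    by (intro tendsto_lowerbound) auto
  moreover have D0: "D {} 0 = Phi {}"
  proof -
    \<comment> \<open>Only the empty set survives at \<open>y = 0\<close>, since
      \<open>0 ^ 0 = 1\<close>.\<close>
    have "D {} 0 = (\<Sum>T\<in>{{}}. 0 ^ card T * Phi T)"
      unfolding D_def using finite_V
      by (intro sum.mono_neutral_cong_right) (auto simp: power_0_left dest: finite_subset)
    then show ?thesis by simp
  qed
  ultimately have "2 * ln (Phi {}) \<le> n * ln (h (z 0))" by (simp add: L_def)
  then have "ln ((Phi {})\<^sup>2) \<le> ln (h (z 0) ^ card V)"
    using assms(2) h_pos[of 0] by (simp add: ln_realpow n_def)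
  then have "(Phi {})\<^sup>2 \<le> h (z 0) ^ card V"
    using assms(2) h_pos[of 0] by (subst (asm) ln_le_cancel_iff) auto
  also have "h (z 0) \<le> (real d)\<^sup>2"
  proof -
    \<comment> \<open>Since h(d + 1) = d^2 + 1 - c / (d + 1)^2, the claim amounts to d^2 - 4d - 1
      being nonnegative, which holds from \<open>d = 5\<close> on.\<close>
    have "real d * 5 \<le> real d * real d" using assms(1) by (intro mult_left_mono) auto
    moreover have "c - (real d + 1)\<^sup>2 = real d * real d - 4 * real d - 1"
      by (simp add: c_def power2_eq_square algebra_simps)
    moreover have "real d \<ge> 5" using assms(1) by simp
    ultimately have "(real d + 1)\<^sup>2 \<le> c" by linarith
    then have "c / (real d + 1)\<^sup>2 \<ge> 1" by (simp add: divide_simps)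
    then show ?thesis by (simp add: h_def z_def power2_eq_square algebra_simps)
  qed
  then have "h (z 0) ^ card V \<le> ((real d)\<^sup>2) ^ card V"
    using h_pos[of 0] by (intro power_mono) auto
  also have "\<dots> = (real d ^ card V)\<^sup>2" by (simp add: power_mult[symmetric] mult.commute)
  finally show ?thesis by (rule power2_le_imp_le) simp
qed

end

section \<open>Degree counts and the bound for regular graphs\<close>

lemma sum_vertex_degree:
  assumes "finite V" "simple_graph V E"
  shows "(\<Sum>v\<in>V. vertex_degree E v) = 2 * card E"
proof -
  have E: "E \<subseteq> Pow V" using assms(2) by (auto simp: simple_graph_def)
  then have finE: "finite E" using assms(1) by (auto intro: finite_subset)
  have "(\<Sum>v\<in>V. vertex_degree E v) = (\<Sum>v\<in>V. \<Sum>e\<in>E. if v \<in> e then 1 else 0)"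
    unfolding vertex_degree_def using finE by (simp add: sum.If_cases Int_def)
  also have "\<dots> = (\<Sum>e\<in>E. \<Sum>v\<in>V. if v \<in> e then 1 else 0)"
    by (rule sum.swap)
  also have "\<dots> = (\<Sum>e\<in>E. card e)"
    using E assms(1) by (intro sum.cong refl) (auto simp: sum.If_cases Int_absorb1)
  also have "\<dots> = 2 * card E"
    using assms(2) by (simp add: simple_graph_def)
  finally show ?thesis .
qed

lemma card_neighbours:
  assumes "simple_graph V E" "finite E"
  shows "card {u. {v, u} \<in> E} = vertex_degree E v"
proof -
  have "bij_betw (\<lambda>u. {v, u}) {u. {v, u} \<in> E} {e \<in> E. v \<in> e}"
  proof (rule bij_betwI')
    fix e assume e: "e \<in> {e \<in> E. v \<in> e}"
    then have "card e = 2" using assms(1) by (auto simp: simple_graph_def)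
    then obtain a b where "e = {a, b}" by (auto simp: card_2_iff)
    then show "\<exists>u\<in>{u. {v, u} \<in> E}. e = {v, u}" using e by (auto simp: insert_commute)
  qed (auto simp: doubleton_eq_iff)
  then show ?thesis by (simp add: vertex_degree_def bij_betw_same_card)
qed

theorem theorem1p4:
  fixes V :: "'a set" and E :: "'a set set" and d n :: nat
  assumes "d \<ge> 2"
    and "finite V" and "simple_graph V E"
    and "regular_graph V E d"
    and "card V = n"
  shows "num_spanning_forests V E \<le> d ^ n"
proof -
  have E: "E \<subseteq> Pow V" using assms(3) by (auto simp: simple_graph_def)
  then have finE: "finite E" using assms(2) by (auto intro: finite_subset)
  have deg: "vertex_degree E v = d" if "v \<in> V" for v
    using assms(4) that by (simp add: regular_graph_def)
  show ?thesis
  proof (cases "d \<ge> 5")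
    case False
    have "n * d = 2 * card E"
      using sum_vertex_degree[OF assms(2,3)] deg assms(5) by simp
    have "spanning_forests V E \<subseteq> Pow E" by (auto simp: spanning_forests_def)
    then have "num_spanning_forests V E \<le> 2 ^ card E"
      unfolding num_spanning_forests_def using finE by (metis card_Pow card_mono finite_Pow_iff)
    \<comment> \<open>Squaring avoids the exponent nd/2, and roots of 2.\<close>
    then have "(num_spanning_forests V E)\<^sup>2 \<le> (2 ^ card E)\<^sup>2"
      by (rule power_mono) simp
    also have "\<dots> = 2 ^ (n * d)"
      unfolding \<open>n * d = 2 * card E\<close> by (simp add: power_mult[symmetric] mult.commute)
    also have "\<dots> = (2 ^ d) ^ n" by (simp add: power_mult[symmetric] mult.commute)
    also have "\<dots> \<le> (d\<^sup>2) ^ n"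
    proof (rule power_mono)
      have "d = 2 \<or> d = 3 \<or> d = 4" using False assms(1) by auto
      \<comment> \<open>Equality holds for \<open>d = 2\<close> and \<open>d = 4\<close>; for
        \<open>d = 3\<close> it reads 8 \<le> 9.\<close>
      then show "2 ^ d \<le> d\<^sup>2" by auto
    qed simp
    also have "\<dots> = (d ^ n)\<^sup>2" by (simp add: power_mult[symmetric] mult.commute)
    finally show ?thesis by (rule power2_le_imp_le) simp
  next
    case True
    have no_loop: "{v} \<notin> E" for v using assms(3) by (auto simp: simple_graph_def)
    have finN: "finite {u. {v, u} \<in> E}" for v
      using E assms(2) by (auto intro: finite_subset)
    interpret separation_weights V "\<lambda>S. real (card (separating_forests E S))"
      "\<lambda>v. {u. {v, u} \<in> E}" d
    proof
      \<comment> \<open>An edge would link two distinct vertices of \<open>V\<close>, so the empty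
        forest alone can separate all of \<open>V\<close>.\<close>
      have "B = {}" if B: "B \<in> separating_forests E V" for B
      proof (rule ccontr)
        assume "B \<noteq> {}"
        then obtain e where e: "e \<in> B" by auto
        then have "e \<subseteq> V" "card e = 2"
          using B assms(3) by (auto simp: separating_forests_def simple_graph_def)
        then obtain a b where "e = {a, b}" "a \<noteq> b" "a \<in> V" "b \<in> V" by (auto simp: card_2_iff)
        then show False using B e linked_edge[of a b B] by (auto simp: separating_forests_def)
      qed
      then have "separating_forests E V \<subseteq> {{}}" by auto
      then have "card (separating_forests E V) \<le> card {{} :: 'a set set}"
        by (intro card_mono) auto
      then show "real (card (separating_forests E V)) \<le> 1" by simp
    next
      fix S v assume "S \<subseteq> V" and v: "v \<in> V - S"
      have card_N: "card {u. {v, u} \<in> E} = d"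
        using card_neighbours[OF assms(3) finE] deg v by simp
      have "card (separating_forests E S) +
          2 * (\<Sum>u\<in>{u. {v, u} \<in> E} - S. card (separating_forests E (insert u (insert v S))))
          \<le> (d + 1) * card (separating_forests E (insert v S))"
        using separating_forests_recursion[OF finE finN no_loop, of v S] v card_N by simp
      from of_nat_mono[OF this, where ?'a = real]
      show "real (card (separating_forests E S)) +
          2 * (\<Sum>u\<in>{u. {v, u} \<in> E} - S. real (card (separating_forests E (insert u (insert v S)))))
          \<le> (real d + 1) * real (card (separating_forests E (insert v S)))"
        by (simp add: algebra_simps)
    next
      fix v assume "v \<in> V"
      then show "card {u. {v, u} \<in> E} = d"
        using card_neighbours[OF assms(3) finE] deg by simp
      show "{u. {v, u} \<in> E} \<subseteq> V - {v}" using E no_loop by auto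
    qed (use assms(2) in auto)
    have "{} \<in> separating_forests E {}"
      by (simp add: separating_forests_def every_edge_bridge_def)
    then have "card (separating_forests E {}) > 0"
      using finite_separating_forests[OF finE] by (auto simp: card_gt_0_iff)
    then have "real (card (separating_forests E {})) \<le> real d ^ n"
      using Phi_empty_le True assms(5) by simp
    then have "card (separating_forests E {}) \<le> d ^ n"
      by (metis of_nat_le_iff of_nat_power)
    moreover have "spanning_forests V E \<subseteq> separating_forests E {}"
    proof
      fix A assume A: "A \<in> spanning_forests V E"
      then have "simple_graph V A" "acyclic_graph V A" "A \<subseteq> E"
        using assms(3) by (auto simp: spanning_forests_def simple_graph_def)
      then show "A \<in> separating_forests E {}"
        by (simp add: separating_forests_def acyclic_graph_every_edge_bridge)
    qed
    then have "num_spanning_forests V E \<le> card (separating_forests E {})"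
      unfolding num_spanning_forests_def
      by (intro card_mono finite_separating_forests finE)
    ultimately show ?thesis by simp
  qed
qed

end
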